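(* Let $r\ge 2$ and let $G$ be a multi $r$-edge-colored complete graph on $n$ vertices. The maximum number of vertices of $G$ coverable by $r-1$ monochromatic components of pairwise different colors equals $\big(1-\frac{r-2}{(r-1)^2}\big)\cdot n$ if and only if $G$ is a blowup of an affine plane.
   Context: A complete graph $G$ is multi $r$-edge-colored if to each pair of distinct vertices $u,v$ a set $\emptyset\neq \mathrm{col}(uv)\subseteq [r]$ is assigned and the coloring is transitive: if $i\in \mathrm{col}(uv)\cap\mathrm{col}(vw)$ for distinct $u,v,w$, then $i\in\mathrm{col}(uw)$. A monochromatic component of color $i$ is a connected component of the spanning subgraph formed by the edges $uv$ with $i\in\mathrm{col}(uv)$. An incidence structure $\mathcal{A}=(\mathcal{P},\mathcal{L})$ (points and lines) is an affine plane of order $r-1$ if: (i) every two points lie on exactly one common line; (ii) for each point $x$ and line $L$ with $x\notin L$ there is exactly one line $L'$ with $x\in L'$ and $L'$ disjoint from $L$; (iii) each line contains at least 2 points; (iv) each point lies on at least 3 lines; (v) the maximum number of pairwise parallel (disjoint) lines is $r-1$. The multi $r$-edge-colored complete graph $G$ is a blowup of an affine plane if there exist an affine plane $\mathcal{A}=(\mathcal{P},\mathcal{L})$, a positive integer $b$ and a map $f:V(G)\to\mathcal{P}$ such that: the lines of $\mathcal{A}$ are colored (with colors in $[r]$) so that two lines have the same color if and only if they are disjoint; $|f^{-1}(p)|=b$ for every point $p$; and $i\in\mathrm{col}(uv)$ if and only if $f(u)$ and $f(v)$ lie on a common line of color $i$ (including the case $f(u)=f(v)$).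
   Formalization: Proved for r ≥ 3 and nonempty G: for r = 2 the claim fails for every G, since one color class is connected, so one component covers all n vertices and equality holds, while no affine plane of order 1 satisfies (i)–(v), so G is never a blowup. *)

theory Defs
  imports Complex_Main "HOL-Library.FuncSet"
begin

text \<open>
  A multi-coloring of the complete graph on \<open>V\<close> assigns the color set \<open>col {u, v}\<close> to the pair
  \<open>{u, v}\<close>, for distinct vertices \<open>u\<close>, \<open>v\<close>; other values of \<open>col\<close> are irrelevant.
  The palette \<open>[r]\<close> is \<open>{1..r}\<close>. As usual, a graph has at least one vertex.
\<close>

definition multi_colored_complete_graph :: "nat \<Rightarrow> 'a set \<Rightarrow> ('a set \<Rightarrow> nat set) \<Rightarrow> bool" where
  "multi_colored_complete_graph r V col \<longleftrightarrow>
     finite V \<and> V \<noteq> {} \<and>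
     (\<forall>u\<in>V. \<forall>v\<in>V. u \<noteq> v \<longrightarrow> col {u, v} \<noteq> {} \<and> col {u, v} \<subseteq> {1..r}) \<and>
     (\<forall>u\<in>V. \<forall>v\<in>V. \<forall>w\<in>V. u \<noteq> v \<and> v \<noteq> w \<and> u \<noteq> w \<longrightarrow>
        col {u, v} \<inter> col {v, w} \<subseteq> col {u, w})"

definition color_adj :: "'a set \<Rightarrow> ('a set \<Rightarrow> nat set) \<Rightarrow> nat \<Rightarrow> ('a \<times> 'a) set" where
  "color_adj V col i = {(u, v). u \<in> V \<and> v \<in> V \<and> u \<noteq> v \<and> i \<in> col {u, v}}"

text \<open>The subgraph of color \<open>i\<close> is spanning, so isolated vertices form singleton components.\<close>

definition mono_components :: "'a set \<Rightarrow> ('a set \<Rightarrow> nat set) \<Rightarrow> nat \<Rightarrow> 'a set set" where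
  "mono_components V col i = V // (color_adj V col i)\<^sup>*"

definition max_coverable :: "nat \<Rightarrow> 'a set \<Rightarrow> ('a set \<Rightarrow> nat set) \<Rightarrow> nat \<Rightarrow> nat" where
  "max_coverable r V col k =
     Max {card (\<Union>i\<in>I. C i) | I C.
            I \<subseteq> {1..r} \<and> card I = k \<and> (\<forall>i\<in>I. C i \<in> mono_components V col i)}"

text \<open>
  Lines are sets of points; this loses no generality, since the first and third
  conditions below force a line of an incidence structure to be determined by its points.
\<close>

definition affine_plane :: "nat \<Rightarrow> 'p set \<Rightarrow> 'p set set \<Rightarrow> bool" where
  "affine_plane q P L \<longleftrightarrow>
     (\<forall>l\<in>L. l \<subseteq> P) \<and>
     (\<forall>x\<in>P. \<forall>y\<in>P. x \<noteq> y \<longrightarrow> (\<exists>!l. l \<in> L \<and> x \<in> l \<and> y \<in> l)) \<and>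
     (\<forall>x\<in>P. \<forall>l\<in>L. x \<notin> l \<longrightarrow> (\<exists>!l'. l' \<in> L \<and> x \<in> l' \<and> disjnt l' l)) \<and>
     (\<forall>l\<in>L. \<exists>x\<in>l. \<exists>y\<in>l. x \<noteq> y) \<and>
     (\<forall>x\<in>P. \<exists>M \<subseteq> L. finite M \<and> card M = 3 \<and> (\<forall>l\<in>M. x \<in> l)) \<and>
     (\<exists>S \<subseteq> L. pairwise disjnt S \<and> finite S \<and> card S = q) \<and>
     (\<forall>S \<subseteq> L. pairwise disjnt S \<longrightarrow> finite S \<and> card S \<le> q)"

definition is_blowup_of ::
  "nat \<Rightarrow> 'a set \<Rightarrow> ('a set \<Rightarrow> nat set) \<Rightarrow> 'p set \<Rightarrow> 'p set set \<Rightarrow> bool" where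
  "is_blowup_of r V col P L \<longleftrightarrow>
     (\<exists>(b::nat) f c. b > 0 \<and> f \<in> V \<rightarrow> P \<and> c \<in> L \<rightarrow> {1..r} \<and>
        (\<forall>l\<in>L. \<forall>l'\<in>L. l \<noteq> l' \<longrightarrow> (c l = c l' \<longleftrightarrow> disjnt l l')) \<and>
        (\<forall>p\<in>P. card {v \<in> V. f v = p} = b) \<and>
        (\<forall>u\<in>V. \<forall>v\<in>V. u \<noteq> v \<longrightarrow>
           (\<forall>i. i \<in> col {u, v} \<longleftrightarrow> (\<exists>l\<in>L. f u \<in> l \<and> f v \<in> l \<and> c l = i))))"

text \<open>
  HOL cannot quantify over the type of the points. Taking points of type \<open>'a set\<close> is no
  restriction: \<open>b > 0\<close> makes \<open>f\<close> surjective, so each point can be renamed to its fibre.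
\<close>

definition is_affine_plane_blowup :: "nat \<Rightarrow> 'a set \<Rightarrow> ('a set \<Rightarrow> nat set) \<Rightarrow> bool" where
  "is_affine_plane_blowup r V col \<longleftrightarrow>
     (\<exists>(P :: 'a set set) L. affine_plane (r - 1) P L \<and> is_blowup_of r V col P L)"

text \<open>
  For two colors the characterization of equality fails for every graph: one of the two colors
  is always connected, so the bound is attained, but there is no affine plane of order 1.
\<close>

lemma no_affine_plane_of_order_1: "\<not> affine_plane (Suc 0) P L"
proof
  assume A: "affine_plane (Suc 0) P L"
  have sub: "\<forall>l\<in>L. l \<subseteq> P"
    and uniq: "\<forall>x\<in>P. \<forall>y\<in>P. x \<noteq> y \<longrightarrow> (\<exists>!l. l \<in> L \<and> x \<in> l \<and> y \<in> l)"
    and par: "\<forall>x\<in>P. \<forall>l\<in>L. x \<notin> l \<longrightarrow> (\<exists>!l'. l' \<in> L \<and> x \<in> l' \<and> disjnt l' l)"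
    and two: "\<forall>l\<in>L. \<exists>x\<in>l. \<exists>y\<in>l. x \<noteq> y"
    and three: "\<forall>x\<in>P. \<exists>M \<subseteq> L. finite M \<and> card M = 3 \<and> (\<forall>l\<in>M. x \<in> l)"
    and ex: "\<exists>S \<subseteq> L. pairwise disjnt S \<and> finite S \<and> card S = Suc 0"
    and mx: "\<forall>S \<subseteq> L. pairwise disjnt S \<longrightarrow> finite S \<and> card S \<le> Suc 0"
    using A unfolding affine_plane_def by - ((elim conjE, assumption)+)
  obtain l where l: "l \<in> L" using ex by (auto simp: card_Suc_eq)
  obtain x where x: "x \<in> l" using two l by blast
  obtain M where M: "M \<subseteq> L" "card M = 3" "\<forall>k\<in>M. x \<in> k" using three sub l x by (meson subsetD)
  have "\<not> M \<subseteq> {l}" using M(2) card_mono[of "{l}" M] by auto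
  then obtain m where m: "m \<in> L" "x \<in> m" "m \<noteq> l" using M by blast
  obtain z where z: "z \<in> m" "z \<noteq> x" using two m(1) by blast
  have P: "x \<in> P" "z \<in> P" using sub l m(1) x z(1) by blast+
  have "z \<notin> l"
  proof
    assume "z \<in> l"
    moreover have "\<exists>!k. k \<in> L \<and> x \<in> k \<and> z \<in> k" using uniq P z(2) by simp
    ultimately show False using l m x z(1) by blast
  qed
  then obtain k where k: "k \<in> L" "z \<in> k" "disjnt k l" using par P(2) l by blast
  have "k \<noteq> l" using k(2) \<open>z \<notin> l\<close> by blast
  then have "card {k, l} = 2" by simp
  moreover have "pairwise disjnt {k, l}" using k(3) by (auto simp: pairwise_insert disjnt_sym)
  moreover have "{k, l} \<subseteq> L" using k(1) l by simp
  ultimately show False using mx[rule_format, of "{k, l}"] by linarith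
qed

lemma two_colors_max_coverable:
  assumes "multi_colored_complete_graph 2 V col"
  shows "max_coverable 2 V col (2 - 1) = card V"
proof -
  have fin: "finite V" and ne: "V \<noteq> {}"
    and colr: "\<And>u v. u \<in> V \<Longrightarrow> v \<in> V \<Longrightarrow> u \<noteq> v \<Longrightarrow> col {u, v} \<noteq> {} \<and> col {u, v} \<subseteq> {1..2}"
    using assms unfolding multi_colored_complete_graph_def by auto
  obtain x where x: "x \<in> V" using ne by blast
  define R where "R i = (color_adj V col i)\<^sup>*" for i
  have RV: "v \<in> V" if "(u, v) \<in> R i" "u \<in> V" for u v i
    using that(1)[unfolded R_def] that(2) by (induction) (auto simp: color_adj_def)
  have step: "(u, v) \<in> R 1 \<or> (u, v) \<in> R 2" if uv: "u \<in> V" "v \<in> V" for u v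
  proof (cases "u = v")
    case False
    obtain k where k: "k \<in> col {u, v}" "k \<in> {1..2}" using colr[OF uv False] by blast
    then have "k = 1 \<or> k = 2" by auto
    with k(1) have "1 \<in> col {u, v} \<or> 2 \<in> col {u, v}" by blast
    then show ?thesis using uv False by (auto simp: R_def color_adj_def)
  qed (simp add: R_def)
  have sym: "(v, u) \<in> R i" if "(u, v) \<in> R i" for u v i
  proof -
    have "sym (color_adj V col i)" by (auto simp: sym_def color_adj_def insert_commute)
    then show ?thesis using that unfolding R_def by (meson symD sym_rtrancl)
  qed
  have tr: "(u, w) \<in> R i" if "(u, v) \<in> R i" "(v, w) \<in> R i" for u v w i
    using that unfolding R_def by simp
  have "\<exists>i\<in>{1, 2}. V \<subseteq> R i `` {x}"
  proof (cases "V \<subseteq> R 1 `` {x}")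
    case False
    then obtain w where w: "w \<in> V" "(x, w) \<notin> R 1" by blast
    have "(x, y) \<in> R 2" if y: "y \<in> V" for y
    proof (cases "(x, y) \<in> R 1")
      case True
      then have "(w, y) \<notin> R 1" using tr[of x y 1 w] sym[of w y 1] w(2) by blast
      then have "(y, w) \<in> R 2" using step[of w y] sym[of w y 2] w(1) y by blast
      moreover have "(x, w) \<in> R 2" using step[of x w] w x by blast
      ultimately show ?thesis using tr[of x w 2 y] sym[of y w 2] by blast
    next
      case False
      then show ?thesis using step[of x y] x y by blast
    qed
    then show ?thesis by blast
  qed blast
  then obtain i where i12: "i = 1 \<or> i = 2" and sub: "V \<subseteq> R i `` {x}" by blast
  have "R i `` {x} \<subseteq> V" using RV x by blast
  with i12 sub have i: "i \<in> {1..2}" "R i `` {x} = V" by auto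
  let ?S = "{card (\<Union>i\<in>I. C i) | I C. I \<subseteq> {1..2} \<and> card I = 2 - 1 \<and>
               (\<forall>i\<in>I. C i \<in> mono_components V col i)}"
  have bd: "n \<le> card V" if "n \<in> ?S" for n
  proof -
    obtain I C where "n = card (\<Union>i\<in>I. C i)" "\<forall>i\<in>I. C i \<in> mono_components V col i"
      using \<open>n \<in> ?S\<close> by blast
    moreover have "K \<subseteq> V" if "K \<in> mono_components V col j" for K j
      using that RV unfolding mono_components_def quotient_def R_def by blast
    ultimately show ?thesis using fin by (auto intro!: card_mono)
  qed
  have "V \<in> mono_components V col i"
    using i(2) x unfolding mono_components_def R_def quotient_def by blast
  then have "card V \<in> ?S"
    using i(1) by (auto intro!: exI[of _ "{i}"] exI[of _ "\<lambda>_. V"])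
  moreover have "finite ?S" using bd by (meson finite_nat_set_iff_bounded_le)
  ultimately show ?thesis using bd unfolding max_coverable_def by (intro Max_eqI) auto
qed

lemma two_colors_not_blowup: "\<not> is_affine_plane_blowup 2 V col"
  by (simp add: is_affine_plane_blowup_def no_affine_plane_of_order_1)

end

theory Submission
  imports Defs "HOL-Library.Disjoint_Sets"
begin

text \<open>
  Fix a component \<open>C\<close> of color \<open>i\<close> and a vertex \<open>x\<close> in it. Omitting a color \<open>j \<noteq> i\<close>, the components
  through \<open>x\<close> of the other colors miss only vertices outside \<open>C\<close> that are joined to \<open>x\<close> in color \<open>j\<close>
  alone; averaging over \<open>j\<close>, some choice misses at most \<open>(n - |C|) / (r - 1)\<close> vertices. Hence if the
  optimum is the stated value, then every component has at most \<open>n / (r - 1)\<close> vertices. Counting the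
  pairs between \<open>C\<close> and its complement by color shows that this is possible only if all components
  have exactly \<open>n / (r - 1)\<close> vertices, components of different colors meet in \<open>n / (r - 1)\<^sup>2\<close> vertices,
  and two vertices have either all colors in common or exactly one. Then the classes of vertices
  with all colors in common are the points, and the components the lines, of an affine plane.
  Conversely, in a blowup of a plane of order \<open>q = r - 1\<close>, \<open>q\<close> lines of different directions meet
  pairwise, so they cover at most \<open>q + (q - 1)\<^sup>2\<close> of the \<open>q\<^sup>2\<close> points, and the averaging argument
  shows that this number is attained.
\<close>

section \<open>Monochromatic components as equivalence classes\<close>

text \<open>The disjunct \<open>u = v\<close> is spelled out because \<open>col\<close> is arbitrary
  on singletons.\<close>

definition mono_class :: "'a set \<Rightarrow> ('a set \<Rightarrow> nat set) \<Rightarrow> nat \<Rightarrow> 'a \<Rightarrow> 'a set" where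
  "mono_class V col i v = {u \<in> V. u = v \<or> i \<in> col {u, v}}"

text \<open>The forward direction and the averaging bound need only one partition of
  \<open>V\<close> per color, such that any two vertices share a class in some color of the palette;
  so the graph is abstracted away.\<close>

locale equivalence_cover =
  fixes r :: nat and V :: "'a set" and K :: "nat \<Rightarrow> 'a \<Rightarrow> 'a set"
  assumes finite_V: "finite V"
    and V_nonempty: "V \<noteq> {}"
    and K_subset: "v \<in> V \<Longrightarrow> K i v \<subseteq> V"
    and K_refl: "v \<in> V \<Longrightarrow> v \<in> K i v"
    and K_eq: "v \<in> V \<Longrightarrow> u \<in> K i v \<Longrightarrow> K i u = K i v"
    and K_cover: "u \<in> V \<Longrightarrow> v \<in> V \<Longrightarrow> \<exists>i\<in>{1..r}. u \<in> K i v"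
begin

lemma finite_K: "v \<in> V \<Longrightarrow> finite (K i v)"
  using K_subset finite_V finite_subset by metis

lemma card_V_pos: "0 < card V"
  using finite_V V_nonempty by (simp add: card_gt_0_iff)

lemma disjoint_classes: "disjoint (K i ` V)"
proof (rule disjointI)
  fix A B assume "A \<in> K i ` V" "B \<in> K i ` V" "A \<noteq> B"
  then show "A \<inter> B = {}" using K_eq by blast
qed

lemma Union_classes: "\<Union> (K i ` V) = V"
  using K_refl K_subset by blast

lemma sum_card_classes:
  assumes "B \<subseteq> V"
  shows "(\<Sum>A\<in>K i ` V. card (A \<inter> B)) = card B"
proof -
  have "card (\<Union>A\<in>K i ` V. A \<inter> B) = (\<Sum>A\<in>K i ` V. card (A \<inter> B))"
  proof (rule card_UN_disjoint)
    show "finite (K i ` V)" using finite_V by simp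
    show "\<forall>A\<in>K i ` V. finite (A \<inter> B)" using finite_K by blast
    show "\<forall>A\<in>K i ` V. \<forall>A'\<in>K i ` V. A \<noteq> A' \<longrightarrow> (A \<inter> B) \<inter> (A' \<inter> B) = {}"
      using disjoint_classes[of i] by (auto simp: disjoint_def)
  qed
  moreover have "(\<Union>A\<in>K i ` V. A \<inter> B) = B" using Union_classes[of i] assms by blast
  ultimately show ?thesis by simp
qed

text \<open>A vertex outside \<open>K i x\<close> is missed by the other classes through \<open>x\<close> for at most one
  choice of the omitted color, so some choice misses at most the average number of vertices.\<close>

lemma exists_color_few_missed:
  assumes "r \<ge> 2" "i \<in> {1..r}" "x \<in> V"
  shows "\<exists>j\<in>{1..r} - {i}.
    (r - 1) * card (V - (\<Union>k\<in>{1..r} - {j}. K k x)) \<le> card V - card (K i x)"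
proof (rule ccontr)
  let ?J = "{1..r} - {i}"
  let ?m = "\<lambda>j. V - (\<Union>k\<in>{1..r} - {j}. K k x)"
  assume "\<not> ?thesis"
  then have gt: "card V - card (K i x) < (r - 1) * card (?m j)" if "j \<in> ?J" for j
    using that by (auto simp: not_le)
  have J: "card ?J = r - 1" "finite ?J" using assms(2) by auto
  then have Jne: "?J \<noteq> {}" using assms(1) by (metis card.empty Suc_1 diff_is_0_eq not_less_eq_eq)
  have disj: "?m j \<inter> ?m j' = {}" if "j \<in> ?J" "j' \<in> ?J" "j \<noteq> j'" for j j'
    using K_cover[OF _ assms(3)] that by blast
  have "(\<Sum>j\<in>?J. card (?m j)) = card (\<Union>j\<in>?J. ?m j)"
    using J disj finite_V by (intro card_UN_disjoint[symmetric]) auto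
  \<comment> \<open>As \<open>j\<close> differs from \<open>i\<close>, the class
    \<open>K i x\<close> is always among those kept.\<close>
  also have "\<dots> \<le> card (V - K i x)"
    using finite_V assms(2) by (intro card_mono) auto
  also have "\<dots> = card V - card (K i x)"
    using K_subset finite_K assms(3) by (intro card_Diff_subset) auto
  finally have le: "(\<Sum>j\<in>?J. card (?m j)) \<le> card V - card (K i x)" .
  have "(r - 1) * (card V - card (K i x)) = (\<Sum>j\<in>?J. card V - card (K i x))"
    using J by simp
  also have "\<dots> < (\<Sum>j\<in>?J. (r - 1) * card (?m j))"
    using J Jne gt by (intro sum_strict_mono) auto
  also have "\<dots> = (r - 1) * (\<Sum>j\<in>?J. card (?m j))" by (rule sum_distrib_left[symmetric])
  also have "\<dots> \<le> (r - 1) * (card V - card (K i x))" using le by simp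
  finally show False by simp
qed

end

section \<open>Sizes of classes and of their intersections\<close>

text \<open>The factor of \<open>c\<close> is the tangent plane at \<open>(t, 1 - t)\<close> of the
  concave function \<open>a * b / (a + b)\<close>. Being linear in \<open>a\<close> and
  \<open>b\<close>, the bound can be summed over a partition. The gap splits into
  \<open>c - (a + b)\<close> times this factor plus a square, so equality makes both terms
  vanish.\<close>

lemma balanced_product_defect:
  fixes a b c t :: real
  assumes "a \<ge> 0" "b \<ge> 0" "a + b \<le> c"
  shows "a * b \<le> c * (t\<^sup>2 * b + (1 - t)\<^sup>2 * a)"
    and "\<lbrakk>c * (t\<^sup>2 * b + (1 - t)\<^sup>2 * a) = a * b; 0 < t; t < 1; 0 < a + b\<rbrakk> \<Longrightarrow> a + b = c \<and> a = t * c"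
proof -
  let ?w = "t\<^sup>2 * b + (1 - t)\<^sup>2 * a"
  have sq: "(a + b) * ?w - a * b = (t * b - (1 - t) * a)\<^sup>2"
    by (simp add: power2_eq_square algebra_simps)
  have w: "0 \<le> ?w" using assms by simp
  have split: "c * ?w - a * b = (c - (a + b)) * ?w + (t * b - (1 - t) * a)\<^sup>2"
    unfolding sq[symmetric] by (simp add: algebra_simps)
  have p: "0 \<le> (c - (a + b)) * ?w" using assms w by (intro mult_nonneg_nonneg) auto
  then show "a * b \<le> c * ?w" using split zero_le_power2[of "t * b - (1 - t) * a"] by linarith
  assume h: "c * ?w = a * b" "0 < t" "t < 1" "0 < a + b"
  have z: "(c - (a + b)) * ?w = 0" "(t * b - (1 - t) * a)\<^sup>2 = 0"
    using split h(1) p zero_le_power2[of "t * b - (1 - t) * a"] by linarith+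
  \<comment> \<open>For \<open>t\<close> strictly between 0 and 1, a zero factor would give
    \<open>a = b = 0\<close>.\<close>
  have "?w \<noteq> 0"
  proof
    assume "?w = 0"
    moreover have "0 \<le> t\<^sup>2 * b" "0 \<le> (1 - t)\<^sup>2 * a" using assms by simp_all
    ultimately have "t\<^sup>2 * b = 0" "(1 - t)\<^sup>2 * a = 0" by linarith+
    then show False using h by simp
  qed
  then have c: "a + b = c" using z(1) by simp
  moreover have "t * b = (1 - t) * a" using z(2) by simp
  then have "a = t * (a + b)" by (simp add: algebra_simps)
  ultimately show "a + b = c \<and> a = t * c" by simp
qed

text \<open>\<open>small\<close> is all that is retained of the assumption on the optimum.\<close>

locale extremal_cover = equivalence_cover +
  assumes r3: "r \<ge> 3"
    and small: "i \<in> {1..r} \<Longrightarrow> v \<in> V \<Longrightarrow> (r - 1) * card (K i v) \<le> card V"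
begin

text \<open>Counts the pairs between a class \<open>C\<close> and its complement by color. With \<open>t = |C| / |V|\<close>, a class
  \<open>A\<close> of another color accounts for \<open>a * b\<close> pairs, where \<open>a = |A \<inter> C|\<close> and \<open>b = |A - C|\<close>, which is
  at most \<open>c * (t\<^sup>2 * b + (1 - t)\<^sup>2 * a)\<close> for \<open>c = |V| / (r - 1)\<close>. These bounds add up to exactly
  the number \<open>|C| * |V - C|\<close> of pairs, so all of them are equalities.\<close>

lemma class_and_intersection_size:
  assumes i: "i \<in> {1..r}" and x: "x \<in> V" and j: "j \<in> {1..r}" "j \<noteq> i" and y: "y \<in> V"
  shows "real (card (K j y)) = real (card V) / real (r - 1)"
    and "real (card (K j y \<inter> K i x)) = real (card (K i x)) / real (r - 1)"
proof -
  let ?C = "K i x" and ?D = "V - K i x" and ?J = "{1..r} - {i}"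
  define n where "n = real (card V)"
  define q where "q = real (r - 1)"
  define m where "m = real (card ?C)"
  define t where "t = m / n"
  define a where "a A = real (card (A \<inter> ?C))" for A
  define b where "b A = real (card (A \<inter> ?D))" for A
  define w where "w A = (n / q) * (t\<^sup>2 * b A + (1 - t)\<^sup>2 * a A)" for A
  define E where "E k = {(u, v). u \<in> ?C \<and> v \<in> ?D \<and> v \<in> K k u}" for k
  have q: "q \<ge> 2" using r3 by (simp add: q_def)
  have n: "n > 0" using card_V_pos by (simp add: n_def)
  have CV: "?C \<subseteq> V" using K_subset x by blast
  have m: "m > 0" using K_refl[OF x] finite_K[OF x, of i] by (auto simp: m_def card_gt_0_iff)
  have "q * m \<le> n" using small[OF i x] unfolding q_def m_def n_def by (metis of_nat_le_iff of_nat_mult)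
  moreover have "2 * m \<le> q * m" using q m by simp
  ultimately have mn: "m < n" using m by linarith
  have t: "0 < t" "t < 1" using m n mn by (auto simp: t_def)
  have J: "finite ?J" "real (card ?J) = q" using i by (auto simp: q_def)
  have cD: "real (card ?D) = n - m"
    using card_Diff_subset[OF finite_K[OF x] CV] card_mono[OF finite_V CV] by (simp add: n_def m_def)
  have ab: "a A + b A = real (card A)" if "A \<in> K k ` V" for A k
  proof -
    have A: "finite A" "A \<subseteq> V" using that finite_K K_subset by blast+
    have "card ((A \<inter> ?C) \<union> (A \<inter> ?D)) = card (A \<inter> ?C) + card (A \<inter> ?D)"
      using A by (intro card_Un_disjoint) auto
    moreover have "(A \<inter> ?C) \<union> (A \<inter> ?D) = A" using A by blast
    ultimately show ?thesis by (simp add: a_def b_def)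
  qed
  have nonneg: "0 \<le> a A" "0 \<le> b A" for A by (simp_all add: a_def b_def)
  have le: "a A + b A \<le> n / q" if "A \<in> K k ` V" "k \<in> ?J" for A k
  proof -
    have "(r - 1) * card A \<le> card V" using that small by blast
    then have "q * real (card A) \<le> n" unfolding q_def n_def by (metis of_nat_le_iff of_nat_mult)
    then show ?thesis using ab[OF that(1)] q by (simp add: field_simps)
  qed
  have defect: "a A * b A \<le> w A" if "A \<in> K k ` V" "k \<in> ?J" for A k
    unfolding w_def using nonneg le[OF that] by (intro balanced_product_defect) auto
  \<comment> \<open>Over the classes of any color, \<open>a\<close> sums to \<open>m\<close> and
    \<open>b\<close> to \<open>n - m\<close>, so the total of \<open>w\<close> does not depend on
    \<open>k\<close>.\<close>
  have sumw: "(\<Sum>A\<in>K k ` V. w A) = m * (n - m) / q" for k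
  proof -
    have "(\<Sum>A\<in>K k ` V. a A) = m"
      using sum_card_classes[OF CV, of k] unfolding a_def m_def by (metis of_nat_sum)
    moreover have "(\<Sum>A\<in>K k ` V. b A) = n - m"
      using sum_card_classes[of ?D k] unfolding b_def cD[symmetric] by (metis Diff_subset of_nat_sum)
    ultimately have "(\<Sum>A\<in>K k ` V. w A) = (n / q) * (t\<^sup>2 * (n - m) + (1 - t)\<^sup>2 * m)"
      by (simp only: w_def sum_distrib_left[symmetric] sum.distrib)
    also have "(n / q) * (t\<^sup>2 * (n - m) + (1 - t)\<^sup>2 * m) = m * (n - m) * (m + (n - m)) / (q * n)"
    proof -
      have "1 - t = (n - m) / n" using n by (simp add: t_def field_simps)
      then have "t\<^sup>2 * (n - m) + (1 - t)\<^sup>2 * m = m * (n - m) * (m + (n - m)) / n\<^sup>2"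
        by (simp add: t_def power_divide add_divide_distrib[symmetric]) (simp add: power2_eq_square algebra_simps)
      then show ?thesis using n by (simp add: power2_eq_square)
    qed
    also have "\<dots> = m * (n - m) / q" using n by simp
    finally show ?thesis .
  qed
  have cardE: "real (card (E k)) = (\<Sum>A\<in>K k ` V. a A * b A)" for k
  proof -
    have "E k = (\<Union>A\<in>K k ` V. (A \<inter> ?C) \<times> (A \<inter> ?D))"
    proof (intro equalityI subsetI)
      fix p assume "p \<in> E k"
      then obtain u v where p: "p = (u, v)" "u \<in> ?C" "v \<in> ?D" "v \<in> K k u" by (auto simp: E_def)
      then have "u \<in> V" using CV by blast
      then show "p \<in> (\<Union>A\<in>K k ` V. (A \<inter> ?C) \<times> (A \<inter> ?D))" using p K_refl by blast
    next
      fix p assume "p \<in> (\<Union>A\<in>K k ` V. (A \<inter> ?C) \<times> (A \<inter> ?D))"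
      then obtain u v z where p: "p = (u, v)" "u \<in> ?C" "v \<in> ?D" "u \<in> K k z" "v \<in> K k z" "z \<in> V"
        by blast
      then show "p \<in> E k" using K_eq[of z u k] by (auto simp: E_def)
    qed
    moreover have "card (\<Union>A\<in>K k ` V. (A \<inter> ?C) \<times> (A \<inter> ?D)) =
        (\<Sum>A\<in>K k ` V. card ((A \<inter> ?C) \<times> (A \<inter> ?D)))"
    proof (rule card_UN_disjoint)
      show "finite (K k ` V)" using finite_V by simp
      show "\<forall>A\<in>K k ` V. finite ((A \<inter> ?C) \<times> (A \<inter> ?D))" using finite_K by blast
      show "\<forall>A\<in>K k ` V. \<forall>A'\<in>K k ` V. A \<noteq> A' \<longrightarrow>
          ((A \<inter> ?C) \<times> (A \<inter> ?D)) \<inter> ((A' \<inter> ?C) \<times> (A' \<inter> ?D)) = {}"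
        using disjoint_classes[of k] by (fastforce simp: disjoint_def)
    qed
    ultimately show ?thesis by (simp add: a_def b_def card_cartesian_product)
  qed
  \<comment> \<open>No pair leaving \<open>?C\<close> shares a class of color \<open>i\<close>. A
    pair sharing classes of several colors is counted repeatedly, which the inequality below
    allows.\<close>
  have "?C \<times> ?D \<subseteq> (\<Union>k\<in>?J. E k)"
  proof
    fix p assume "p \<in> ?C \<times> ?D"
    then obtain u v where p: "p = (u, v)" "u \<in> ?C" "v \<in> ?D" by blast
    then have uV: "u \<in> V" "v \<in> V" using CV by auto
    obtain k where k: "k \<in> {1..r}" "v \<in> K k u" using K_cover[OF uV(2,1)] by blast
    have "k \<noteq> i" using k p K_eq[OF x, of u i] by auto
    then show "p \<in> (\<Union>k\<in>?J. E k)" using k p by (auto simp: E_def)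
  qed
  moreover have finE: "finite (E k)" for k
    by (rule finite_subset[of _ "V \<times> V"]) (use CV finite_V in \<open>auto simp: E_def\<close>)
  ultimately have "card (?C \<times> ?D) \<le> card (\<Union>k\<in>?J. E k)" using J by (intro card_mono) auto
  also have "\<dots> \<le> (\<Sum>k\<in>?J. card (E k))" using J by (intro card_UN_le) auto
  finally have "real (card (?C \<times> ?D)) \<le> real (\<Sum>k\<in>?J. card (E k))" using of_nat_le_iff by blast
  then have pairs: "m * (n - m) \<le> (\<Sum>k\<in>?J. \<Sum>A\<in>K k ` V. a A * b A)"
    by (simp add: card_cartesian_product cD m_def cardE)
  have "(\<Sum>k\<in>?J. \<Sum>A\<in>K k ` V. w A) = q * (m * (n - m) / q)" unfolding sumw using J by simp
  also have "\<dots> = m * (n - m)" using q by simp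
  \<comment> \<open>The defects \<open>w A - a A * b A\<close> are nonnegative with total at most
    zero, so each vanishes, in particular that of \<open>K j y\<close>.\<close>
  finally have tot: "(\<Sum>k\<in>?J. \<Sum>A\<in>K k ` V. w A - a A * b A) \<le> 0"
    using pairs by (simp add: sum_subtractf)
  have nn: "0 \<le> (\<Sum>A\<in>K k ` V. w A - a A * b A)" if "k \<in> ?J" for k
    using defect that by (intro sum_nonneg) auto
  have "(\<Sum>k\<in>?J. \<Sum>A\<in>K k ` V. w A - a A * b A) = 0"
    by (rule antisym[OF tot sum_nonneg[OF nn]])
  then have "(\<Sum>A\<in>K j ` V. w A - a A * b A) = 0"
    using sum_nonneg_eq_0_iff[of ?J "\<lambda>k. \<Sum>A\<in>K k ` V. w A - a A * b A"] J nn j by auto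
  then have "w (K j y) - a (K j y) * b (K j y) = 0"
    using sum_nonneg_eq_0_iff[of "K j ` V" "\<lambda>A. w A - a A * b A"] finite_V defect j y by auto
  then have eq: "(n / q) * (t\<^sup>2 * b (K j y) + (1 - t)\<^sup>2 * a (K j y)) = a (K j y) * b (K j y)"
    by (simp add: w_def)
  have pos: "0 < a (K j y) + b (K j y)"
    using ab[of "K j y" j] y K_refl[OF y, of j] finite_K[OF y, of j] by (auto simp: card_gt_0_iff)
  have res: "a (K j y) + b (K j y) = n / q" "a (K j y) = t * (n / q)"
    using balanced_product_defect(2)[OF nonneg le eq t pos, of j] j y by auto
  show "real (card (K j y)) = real (card V) / real (r - 1)"
    using res(1) ab[of "K j y" j] y by (simp add: n_def q_def)
  show "real (card (K j y \<inter> ?C)) = real (card ?C) / real (r - 1)"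
    using res(2) n by (simp add: t_def a_def m_def q_def)
qed

text \<open>\<open>class_and_intersection_size\<close> measures only classes whose color differs
  from that of the reference class; a second color makes it apply to every class.\<close>

lemma other_color: "\<exists>j\<in>{1..r}. j \<noteq> i"
proof (cases "i = 1")
  case True
  then show ?thesis using r3 by (intro bexI[of _ 2]) auto
next
  case False
  then show ?thesis using r3 by (intro bexI[of _ 1]) auto
qed

lemma card_K: "j \<in> {1..r} \<Longrightarrow> y \<in> V \<Longrightarrow> real (card (K j y)) = real (card V) / real (r - 1)"
  using class_and_intersection_size(1) other_color[of j] by metis

lemma card_K_Int:
  assumes "i \<in> {1..r}" "j \<in> {1..r}" "i \<noteq> j" "x \<in> V" "y \<in> V"
  shows "real (card (K i x \<inter> K j y)) = real (card V) / (real (r - 1))\<^sup>2"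
  using class_and_intersection_size(2)[of j y i x] card_K[of j y] assms
  by (simp add: power2_eq_square)

section \<open>Points and lines\<close>

definition point :: "'a \<Rightarrow> 'a set" where
  "point v = (\<Inter>i\<in>{1..r}. K i v)"

definition line :: "nat \<Rightarrow> 'a \<Rightarrow> 'a set set" where
  "line i v = point ` K i v"

definition all_lines :: "'a set set set" where
  "all_lines = {line i v | i v. i \<in> {1..r} \<and> v \<in> V}"

text \<open>A line is a bare set of points, but it determines its color: lines of different colors
  share a single point, while every line has at least two.\<close>

definition line_color :: "'a set set \<Rightarrow> nat" where
  "line_color l = (THE i. i \<in> {1..r} \<and> (\<exists>v\<in>V. l = line i v))"

lemma point_subset: "v \<in> V \<Longrightarrow> point v \<subseteq> V"
  using K_subset[of v 1] r3 by (auto simp: point_def)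

lemma point_refl: "v \<in> V \<Longrightarrow> v \<in> point v"
  using K_refl by (simp add: point_def)

lemma point_eq:
  assumes "v \<in> V" "u \<in> point v"
  shows "point u = point v"
proof -
  have "K i u = K i v" if "i \<in> {1..r}" for i
    using K_eq[OF assms(1)] assms(2) that by (simp add: point_def)
  then show ?thesis by (simp add: point_def)
qed

lemma point_eq_iff: "u \<in> V \<Longrightarrow> v \<in> V \<Longrightarrow> point u = point v \<longleftrightarrow> u \<in> point v"
  using point_eq point_refl by blast

text \<open>The traces of the classes through \<open>v\<close> on the complement of \<open>K k v\<close> cover it, and by the known
  sizes their cardinalities add up to that of the complement; so they are disjoint.\<close>

lemma two_colors_imp_point:
  assumes ij: "i \<in> {1..r}" "j \<in> {1..r}" "i \<noteq> j" and v: "v \<in> V"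
    and u: "u \<in> K i v" "u \<in> K j v"
  shows "u \<in> point v"
proof (rule ccontr)
  assume "u \<notin> point v"
  then obtain k where k: "k \<in> {1..r}" "u \<notin> K k v" by (auto simp: point_def)
  let ?J = "{1..r} - {k}" and ?D = "V - K k v"
  define n where "n = real (card V)"
  define q where "q = real (r - 1)"
  define d where "d z = card {l \<in> ?J. z \<in> K l v}" for z
  have q: "q \<ge> 2" using r3 by (simp add: q_def)
  have J: "finite ?J" "real (card ?J) = q" using k by (auto simp: q_def)
  have CV: "K k v \<subseteq> V" using K_subset v by blast
  have cD: "real (card ?D) = n - n / q"
    using card_Diff_subset[OF finite_K[OF v] CV] card_mono[OF finite_V CV] card_K[OF k(1) v]
    by (simp add: n_def q_def)
  have part: "real (card {z \<in> ?D. z \<in> K l v}) = n / q - n / q\<^sup>2" if "l \<in> ?J" for l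
  proof -
    have "{z \<in> ?D. z \<in> K l v} = K l v - (K l v \<inter> K k v)" using K_subset[OF v] by blast
    then have "card {z \<in> ?D. z \<in> K l v} = card (K l v) - card (K l v \<inter> K k v)"
      using finite_K[OF v] by (simp add: card_Diff_subset)
    moreover have "card (K l v \<inter> K k v) \<le> card (K l v)" using finite_K[OF v] by (intro card_mono) auto
    ultimately show ?thesis using card_K[of l v] card_K_Int[of l k v v] that k v
      by (simp add: n_def q_def)
  qed
  have "(\<Sum>z\<in>?D. d z) = (\<Sum>l\<in>?J. card {z \<in> ?D. z \<in> K l v})"
    unfolding d_def using finite_V J by (intro sum_multicount_gen) auto
  then have "real (\<Sum>z\<in>?D. d z) = (\<Sum>l\<in>?J. real (card {z \<in> ?D. z \<in> K l v}))"
    by (simp only: of_nat_sum)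
  also have "\<dots> = (\<Sum>l\<in>?J. n / q - n / q\<^sup>2)" by (rule sum.cong[OF refl part])
  also have "\<dots> = q * (n / q - n / q\<^sup>2)" using J by simp
  also have "\<dots> = real (card ?D)" using q unfolding cD by (simp add: power2_eq_square field_simps)
  finally have eq: "(\<Sum>z\<in>?D. d z) = (\<Sum>z\<in>?D. 1)" by (simp del: of_nat_sum)
  have ge: "1 \<le> d z" if z: "z \<in> ?D" for z
  proof -
    obtain l where "l \<in> {1..r}" "z \<in> K l v" using K_cover z v by blast
    then have "{l \<in> ?J. z \<in> K l v} \<noteq> {}" using z by blast
    then have "0 < d z" using J unfolding d_def by (simp add: card_gt_0_iff)
    then show ?thesis by simp
  qed
  have uD: "u \<in> ?D" using u(1) k(2) K_subset[OF v] by blast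
  \<comment> \<open>Neither \<open>i\<close> nor \<open>j\<close> is \<open>k\<close>, since
    \<open>u\<close> lies in \<open>K i v\<close> and \<open>K j v\<close> but not in
    \<open>K k v\<close>; hence \<open>u\<close> is covered twice.\<close>
  have "{i, j} \<subseteq> {l \<in> ?J. u \<in> K l v}" using ij u k by auto
  then have "card {i, j} \<le> d u" unfolding d_def using J by (intro card_mono) auto
  then have "1 < d u" using ij by simp
  then have "(\<Sum>z\<in>?D. 1) < (\<Sum>z\<in>?D. d z)"
    using finite_V ge uD by (intro sum_strict_mono_ex1) auto
  then show False using eq by simp
qed

lemma point_eq_Int:
  assumes "i \<in> {1..r}" "j \<in> {1..r}" "i \<noteq> j" "v \<in> V"
  shows "point v = K i v \<inter> K j v"
  using two_colors_imp_point[OF assms] assms(1,2) unfolding point_def by blast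

lemma card_point:
  assumes "v \<in> V"
  shows "real (card (point v)) = real (card V) / (real (r - 1))\<^sup>2"
proof -
  have "1 \<in> {1..r}" "2 \<in> {1..r}" "(1::nat) \<noteq> 2" using r3 by auto
  then show ?thesis using card_K_Int point_eq_Int assms by metis
qed

text \<open>For a color of the palette each class is a union of points, so it can be recovered from
  its line.\<close>

lemma point_in_line_iff:
  assumes "i \<in> {1..r}" "u \<in> V" "v \<in> V"
  shows "point u \<in> line i v \<longleftrightarrow> u \<in> K i v"
proof
  assume "point u \<in> line i v"
  then obtain w where w: "w \<in> K i v" "point u = point w" by (auto simp: line_def)
  then have "w \<in> V" using K_subset assms by blast
  then have "u \<in> point w" using w point_eq_iff assms by blast
  then have "u \<in> K i w" using assms by (auto simp: point_def)
  then show "u \<in> K i v" using K_eq[of v w i] w assms by simp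
qed (simp add: line_def)

lemma line_subset: "v \<in> V \<Longrightarrow> line i v \<subseteq> point ` V"
  using K_subset by (auto simp: line_def)

lemma line_cong: "v \<in> V \<Longrightarrow> u \<in> K i v \<Longrightarrow> line i u = line i v"
  unfolding line_def by (simp only: K_eq)

text \<open>The two classes meet in \<open>card V / (r - 1)^2\<close> vertices, which is positive,
  and by \<open>point_eq_Int\<close> all common vertices form one point.\<close>

lemma lines_meet:
  assumes "i \<in> {1..r}" "j \<in> {1..r}" "i \<noteq> j" "u \<in> V" "v \<in> V"
  shows "\<exists>w\<in>V. line i u \<inter> line j v = {point w}"
proof -
  have "0 < card (K i u \<inter> K j v)" using card_K_Int[OF assms] card_V_pos r3
    by (metis divide_pos_pos of_nat_0_less_iff zero_less_power diff_gt_0_iff_gt zero_less_diff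
        less_le_trans numeral_One one_less_numeral_iff semiring_norm(77))
  then obtain w where w: "w \<in> K i u" "w \<in> K j v"
    by (metis card_gt_0_iff ex_in_conv IntE)
  have wV: "w \<in> V" using w K_subset assms by blast
  have "p = point w" if p: "p \<in> line i u" "p \<in> line j v" for p
  proof -
    obtain z where z: "z \<in> V" "p = point z" using p line_subset assms by blast
    then have "z \<in> K i u" "z \<in> K j v" using p point_in_line_iff assms by auto
    moreover have "K i w = K i u" "K j w = K j v" using K_eq w assms by blast+
    ultimately have "z \<in> K i w \<inter> K j w" by simp
    then have "z \<in> point w" using point_eq_Int[OF assms(1-3) wV] by simp
    then show ?thesis using z wV point_eq_iff by simp
  qed
  moreover have "point w \<in> line i u" "point w \<in> line j v" using w by (auto simp: line_def)
  ultimately show ?thesis using wV by blast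
qed

text \<open>A class is \<open>r - 1\<close> times as large as a point, and \<open>r - 1\<close>
  exceeds 1.\<close>

lemma line_two_points:
  assumes "i \<in> {1..r}" "v \<in> V"
  shows "\<exists>p\<in>line i v. \<exists>p'\<in>line i v. p \<noteq> p'"
proof -
  have "real (card (point v)) < real (card (K i v))"
  proof -
    have "n / q\<^sup>2 < n / q" if "0 < n" "1 < q" for n q :: real
      using that by (simp add: power2_eq_square field_simps)
    then have "real (card V) / (real (r - 1))\<^sup>2 < real (card V) / real (r - 1)"
      using card_V_pos r3 by simp
    then show ?thesis using assms by (simp only: card_point card_K)
  qed
  then have "\<not> K i v \<subseteq> point v"
    using card_mono[of "point v" "K i v"] point_subset finite_V finite_subset assms
    by (metis not_less of_nat_less_iff)
  then obtain u where u: "u \<in> K i v" "u \<notin> point v" by blast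
  then have "point u \<noteq> point v" using point_eq_iff K_subset assms by blast
  moreover have "point u \<in> line i v" "point v \<in> line i v" using u K_refl assms by (auto simp: line_def)
  ultimately show ?thesis by blast
qed

lemma line_not_disjoint_imp_eq:
  assumes "i \<in> {1..r}" "u \<in> V" "v \<in> V" "\<not> disjnt (line i u) (line i v)"
  shows "line i u = line i v"
proof -
  obtain p where p: "p \<in> line i u" "p \<in> line i v" using assms by (auto simp: disjnt_def)
  then obtain w where "w \<in> V" "p = point w" using line_subset assms by blast
  then show ?thesis using p point_in_line_iff line_cong assms by metis
qed

lemma line_eq_imp_color_eq:
  assumes "i \<in> {1..r}" "j \<in> {1..r}" "u \<in> V" "v \<in> V" "line i u = line j v"
  shows "i = j"
proof (rule ccontr)
  assume "i \<noteq> j"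
  then obtain w where "line i u \<inter> line j v = {point w}" using lines_meet assms by metis
  then have "line i u = {point w}" using assms by simp
  then show False using line_two_points[OF assms(1,3)] by auto
qed

lemma disjnt_lines_imp_color_eq:
  assumes "i \<in> {1..r}" "j \<in> {1..r}" "u \<in> V" "v \<in> V" "disjnt (line i u) (line j v)"
  shows "i = j"
  by (rule ccontr) (use lines_meet[OF assms(1,2) _ assms(3,4)] assms(5) in \<open>auto simp: disjnt_def\<close>)

lemma line_color_line: "i \<in> {1..r} \<Longrightarrow> v \<in> V \<Longrightarrow> line_color (line i v) = i"
  unfolding line_color_def
proof (rule the_equality)
  fix j assume "i \<in> {1..r}" "v \<in> V" "j \<in> {1..r} \<and> (\<exists>w\<in>V. line i v = line j w)"
  then show "j = i" using line_eq_imp_color_eq[of i j v] by auto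
qed blast

text \<open>The classes of a color partition \<open>V\<close> into parts of size
  \<open>card V / (r - 1)\<close>.\<close>

lemma card_lines_of_color:
  assumes "i \<in> {1..r}"
  shows "card (line i ` V) = r - 1" "finite (line i ` V)"
proof -
  show "finite (line i ` V)" using finite_V by simp
  have "inj_on ((`) point) (K i ` V)"
  proof (rule inj_onI, clarify)
    fix u v assume uv: "u \<in> V" "v \<in> V" "point ` K i u = point ` K i v"
    then have "point u \<in> line i v" using K_refl by (metis imageI line_def)
    then show "K i u = K i v" using point_in_line_iff K_eq uv assms by blast
  qed
  then have "card (line i ` V) = card (K i ` V)"
    using card_image[of "(`) point" "K i ` V"] by (simp add: image_image line_def)
  moreover have "real (card (K i ` V)) = real (r - 1)"
  proof -
    have "real (card V) = (\<Sum>A\<in>K i ` V. real (card (A \<inter> V)))"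
      using sum_card_classes[of V i] by (metis of_nat_sum order_refl)
    also have "\<dots> = (\<Sum>A\<in>K i ` V. real (card V) / real (r - 1))"
    proof (rule sum.cong)
      fix A assume "A \<in> K i ` V"
      then obtain v where "v \<in> V" "A = K i v" by blast
      then show "real (card (A \<inter> V)) = real (card V) / real (r - 1)"
        using card_K[OF assms] K_subset[of v i] by (simp add: Int_absorb2)
    qed simp
    finally have "real (card V) = real (card (K i ` V)) * (real (card V) / real (r - 1))" by simp
    moreover have "k = q" if "n = k * (n / q)" "n > 0" "q > 0" for n k q :: real
      using that by (simp add: field_simps)
    from this[OF calculation] show ?thesis using card_V_pos r3 by simp
  qed
  ultimately show "card (line i ` V) = r - 1" by simp
qed

section \<open>The affine plane and the blowup map\<close>

text \<open>Parallelism is equality of color: disjoint lines share their color, and distinct lines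
  of one color are disjoint. So the parallel through a point is the line of the same color there,
  and a family of pairwise disjoint lines lies within one color, which has \<open>r - 1\<close>
  lines.\<close>

lemma affine_plane_points_lines: "affine_plane (r - 1) (point ` V) all_lines"
  unfolding affine_plane_def
proof (intro conjI ballI allI impI)
  fix l assume "l \<in> all_lines"
  then show "l \<subseteq> point ` V" using line_subset by (auto simp: all_lines_def)
next
  fix p p' assume "p \<in> point ` V" "p' \<in> point ` V" "p \<noteq> p'"
  then obtain u v where uv: "u \<in> V" "v \<in> V" "p = point u" "p' = point v" "u \<notin> point v"
    using point_eq_iff by blast
  obtain i where i: "i \<in> {1..r}" "u \<in> K i v" using K_cover uv by blast
  show "\<exists>!l. l \<in> all_lines \<and> p \<in> l \<and> p' \<in> l"
  proof (rule ex1I[of _ "line i v"])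
    show "line i v \<in> all_lines \<and> p \<in> line i v \<and> p' \<in> line i v"
      using i uv K_refl by (auto simp: all_lines_def line_def)
    fix l assume "l \<in> all_lines \<and> p \<in> l \<and> p' \<in> l"
    then obtain j w where j: "j \<in> {1..r}" "w \<in> V" "l = line j w" "u \<in> K j w" "v \<in> K j w"
      using point_in_line_iff uv unfolding all_lines_def by blast
    then have "u \<in> K j v" using K_eq by metis
    \<comment> \<open>Sharing classes of two colors would put \<open>u\<close> and \<open>v\<close>
      into the same point.\<close>
    then have "j = i" using two_colors_imp_point i uv j by blast
    then show "l = line i v" using j line_cong by simp
  qed
next
  fix p l assume "p \<in> point ` V" "l \<in> all_lines" "p \<notin> l"
  then obtain u i v where uv: "u \<in> V" "p = point u" "i \<in> {1..r}" "v \<in> V" "l = line i v" "p \<notin> l"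
    by (auto simp: all_lines_def)
  have pl: "p \<in> line i u" using uv K_refl by (simp add: line_def)
  show "\<exists>!l'. l' \<in> all_lines \<and> p \<in> l' \<and> disjnt l' l"
  proof (rule ex1I[of _ "line i u"])
    have "disjnt (line i u) (line i v)" using line_not_disjoint_imp_eq[OF uv(3,1,4)] uv pl by auto
    then show "line i u \<in> all_lines \<and> p \<in> line i u \<and> disjnt (line i u) l"
      using uv pl by (auto simp: all_lines_def)
    fix l' assume l': "l' \<in> all_lines \<and> p \<in> l' \<and> disjnt l' l"
    then obtain j w where j: "j \<in> {1..r}" "w \<in> V" "l' = line j w" by (auto simp: all_lines_def)
    then have "j = i" using l' uv disjnt_lines_imp_color_eq by metis
    then show "l' = line i u" using l' j uv point_in_line_iff line_cong by metis
  qed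
next
  fix l assume "l \<in> all_lines"
  then show "\<exists>x\<in>l. \<exists>y\<in>l. x \<noteq> y" using line_two_points by (auto simp: all_lines_def)
next
  fix p assume "p \<in> point ` V"
  then obtain v where v: "v \<in> V" "p = point v" by blast
  let ?M = "(\<lambda>i. line i v) ` {1..3}"
  have "inj_on (\<lambda>i. line i v) {1..3}"
    using line_eq_imp_color_eq r3 v by (intro inj_onI) (metis atLeastAtMost_iff order_trans)
  then have "card ?M = 3" by (simp add: card_image)
  moreover have "?M \<subseteq> all_lines" using r3 v by (fastforce simp: all_lines_def)
  moreover have "\<forall>l\<in>?M. p \<in> l" using v K_refl by (auto simp: line_def)
  ultimately show "\<exists>M\<subseteq>all_lines. finite M \<and> card M = 3 \<and> (\<forall>l\<in>M. p \<in> l)" by blast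
next
  have one: "1 \<in> {1..r}" using r3 by simp
  have "pairwise disjnt (line 1 ` V)"
    using line_not_disjoint_imp_eq[OF one] by (auto simp: pairwise_def)
  moreover have "line 1 ` V \<subseteq> all_lines" using one by (auto simp: all_lines_def)
  ultimately show "\<exists>S\<subseteq>all_lines. pairwise disjnt S \<and> finite S \<and> card S = r - 1"
    using card_lines_of_color[OF one] by blast
next
  fix S assume S: "S \<subseteq> all_lines" "pairwise disjnt S"
  obtain i where i: "i \<in> {1..r}" "S \<subseteq> line i ` V"
  proof (cases "S = {}")
    case True
    then show ?thesis using that[of 1] r3 by simp
  next
    case False
    then obtain l where l: "l \<in> S" by blast
    then obtain i v where i: "i \<in> {1..r}" "v \<in> V" "l = line i v" using S by (auto simp: all_lines_def)
    have "l' \<in> line i ` V" if l': "l' \<in> S" for l'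
    proof (cases "l' = l")
      case False
      obtain j w where j: "j \<in> {1..r}" "w \<in> V" "l' = line j w" using S l' by (auto simp: all_lines_def)
      have "disjnt l' l" using S(2) l l' False by (simp add: pairwise_def)
      then have "j = i" using disjnt_lines_imp_color_eq i j by metis
      then show ?thesis using j by blast
    qed (use i in blast)
    then show ?thesis using that i by blast
  qed
  show "finite S" using i(2) card_lines_of_color(2)[OF i(1)] by (rule finite_subset)
  show "card S \<le> r - 1"
    using card_mono[OF card_lines_of_color(2)[OF i(1)] i(2)] card_lines_of_color(1)[OF i(1)] by simp
qed

lemma extremal_is_blowup:
  assumes col: "\<And>u v i. u \<in> V \<Longrightarrow> v \<in> V \<Longrightarrow> u \<noteq> v \<Longrightarrow> i \<in> col {u, v} \<longleftrightarrow> i \<in> {1..r} \<and> u \<in> K i v"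
  shows "is_blowup_of r V col (point ` V) all_lines"
proof -
  obtain x where x: "x \<in> V" using V_nonempty by blast
  show ?thesis
    unfolding is_blowup_of_def
  proof (intro exI conjI ballI allI impI)
    \<comment> \<open>Unification with this goal and the next two fixes the witnesses:
      \<open>card (point x)\<close> for \<open>b\<close>, \<open>point\<close> for the map and
      \<open>line_color\<close> for the coloring. The fibres of \<open>point\<close> are the points
      themselves, which all have the same size.\<close>
    show "card (point x) > 0"
      using x point_refl[of x] point_subset[of x] finite_V finite_subset by (metis card_gt_0_iff empty_iff)
    show "point \<in> V \<rightarrow> point ` V" by simp
    show "line_color \<in> all_lines \<rightarrow> {1..r}" by (force simp: all_lines_def line_color_line)
    show "(line_color l = line_color l') = disjnt l l'"
      if l: "l \<in> all_lines" "l' \<in> all_lines" "l \<noteq> l'" for l l'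
    proof -
      obtain i u j v where "i \<in> {1..r}" "u \<in> V" "l = line i u" "j \<in> {1..r}" "v \<in> V" "l' = line j v"
        using l by (auto simp: all_lines_def)
      then show ?thesis
        using l line_color_line line_not_disjoint_imp_eq disjnt_lines_imp_color_eq by metis
    qed
    show "card {v \<in> V. point v = p} = card (point x)" if p: "p \<in> point ` V" for p
    proof -
      obtain v where v: "v \<in> V" "p = point v" using p by blast
      then have "{u \<in> V. point u = p} = point v" using point_eq_iff point_subset by blast
      moreover have "real (card (point v)) = real (card (point x))" using card_point v x by simp
      ultimately show ?thesis by simp
    qed
    show "i \<in> col {u, v} \<longleftrightarrow> (\<exists>l\<in>all_lines. point u \<in> l \<and> point v \<in> l \<and> line_color l = i)"
      if uv: "u \<in> V" "v \<in> V" "u \<noteq> v" for u v i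
    proof
      assume "i \<in> col {u, v}"
      then have i: "i \<in> {1..r}" "u \<in> K i v" using col uv by auto
      then have "line i v \<in> all_lines" "point u \<in> line i v" "point v \<in> line i v"
        using uv K_refl by (auto simp: all_lines_def line_def)
      then show "\<exists>l\<in>all_lines. point u \<in> l \<and> point v \<in> l \<and> line_color l = i"
        using line_color_line i uv by blast
    next
      assume "\<exists>l\<in>all_lines. point u \<in> l \<and> point v \<in> l \<and> line_color l = i"
      then obtain j w where j: "j \<in> {1..r}" "w \<in> V" "point u \<in> line j w" "point v \<in> line j w"
        "line_color (line j w) = i" by (auto simp: all_lines_def)
      then have "j = i" using line_color_line by simp
      then have "u \<in> K i w" "v \<in> K i w" using j uv point_in_line_iff by auto
      then show "i \<in> col {u, v}" using col uv K_eq j \<open>j = i\<close> by metis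
    qed
  qed
qed

end

section \<open>From colorings to partitions, and bounds on the optimum\<close>

lemma equivalence_cover_mono_class:
  assumes "multi_colored_complete_graph r V col" "r \<ge> 1"
  shows "equivalence_cover r V (mono_class V col)"
proof
  have fin: "finite V" and ne: "V \<noteq> {}"
    and colr: "\<And>u v. u \<in> V \<Longrightarrow> v \<in> V \<Longrightarrow> u \<noteq> v \<Longrightarrow> col {u, v} \<noteq> {} \<and> col {u, v} \<subseteq> {1..r}"
    and tr: "\<And>u v w. u \<in> V \<Longrightarrow> v \<in> V \<Longrightarrow> w \<in> V \<Longrightarrow> u \<noteq> v \<Longrightarrow> v \<noteq> w \<Longrightarrow> u \<noteq> w \<Longrightarrow>
      col {u, v} \<inter> col {v, w} \<subseteq> col {u, w}"
    using assms(1) unfolding multi_colored_complete_graph_def by auto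
  show "finite V" "V \<noteq> {}" by fact+
  show "mono_class V col i v \<subseteq> V" for i v by (auto simp: mono_class_def)
  show "v \<in> mono_class V col i v" if "v \<in> V" for i v using that by (simp add: mono_class_def)
  show "mono_class V col i u = mono_class V col i v" if "v \<in> V" "u \<in> mono_class V col i v" for i u v
  proof (cases "u = v")
    case False
    then have u: "u \<in> V" "i \<in> col {u, v}" "i \<in> col {v, u}"
      using that by (auto simp: mono_class_def insert_commute)
    have "w = u \<or> i \<in> col {w, u} \<longleftrightarrow> w = v \<or> i \<in> col {w, v}" if "w \<in> V" for w
      using tr[of w u v] tr[of w v u] u False that \<open>v \<in> V\<close> by blast
    then show ?thesis by (auto simp: mono_class_def)
  qed simp
  show "\<exists>i\<in>{1..r}. u \<in> mono_class V col i v" if uv: "u \<in> V" "v \<in> V" for u v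
  proof (cases "u = v")
    case True
    then show ?thesis using uv assms(2) by (intro bexI[of _ 1]) (auto simp: mono_class_def)
  next
    case False
    then obtain i where "i \<in> col {u, v}" "i \<in> {1..r}" using colr[OF uv] by blast
    then show ?thesis using uv by (auto simp: mono_class_def)
  qed
qed

text \<open>Transitivity of the coloring shortens every monochromatic path between distinct vertices
  to a single edge.\<close>

lemma mono_components_eq_classes:
  assumes "multi_colored_complete_graph r V col" "r \<ge> 1"
  shows "mono_components V col i = mono_class V col i ` V"
proof -
  interpret equivalence_cover r V "mono_class V col" by (rule equivalence_cover_mono_class[OF assms])
  have "(color_adj V col i)\<^sup>* `` {v} = mono_class V col i v" if v: "v \<in> V" for v
  proof (intro equalityI subsetI)
    fix u assume "u \<in> (color_adj V col i)\<^sup>* `` {v}"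
    then have "(v, u) \<in> (color_adj V col i)\<^sup>*" by simp
    then show "u \<in> mono_class V col i v"
    proof induction
      case base
      then show ?case using K_refl v by blast
    next
      case (step y z)
      then have "z \<in> mono_class V col i y" by (auto simp: color_adj_def mono_class_def insert_commute)
      then show ?case using K_eq[OF v step.IH] by simp
    qed
  next
    fix u assume "u \<in> mono_class V col i v"
    then have "u = v \<or> (v, u) \<in> color_adj V col i"
      using v by (auto simp: mono_class_def color_adj_def insert_commute)
    then show "u \<in> (color_adj V col i)\<^sup>* `` {v}" by auto
  qed
  then show ?thesis by (auto simp: mono_components_def quotient_def)
qed

text \<open>\<open>Max\<close> is meaningful because the set of values is bounded by
  \<open>card V\<close> and, as \<open>k\<close> is at most \<open>r\<close>, contains the value for
  the colors \<open>1..k\<close>.\<close>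

lemma max_coverable_properties:
  fixes r :: nat
  assumes "multi_colored_complete_graph r V col" "r \<ge> 1" "k \<le> r"
  defines "S \<equiv> {card (\<Union>i\<in>I. C i) | I C.
            I \<subseteq> {1..r} \<and> card I = k \<and> (\<forall>i\<in>I. C i \<in> mono_class V col i ` V)}"
  shows "max_coverable r V col k \<in> S" "x \<in> S \<Longrightarrow> x \<le> max_coverable r V col k"
proof -
  interpret equivalence_cover r V "mono_class V col" by (rule equivalence_cover_mono_class[OF assms(1,2)])
  have M: "max_coverable r V col k = Max S"
    unfolding max_coverable_def S_def mono_components_eq_classes[OF assms(1,2)] ..
  have "x \<le> card V" if x: "x \<in> S" for x
  proof -
    obtain I C where IC: "x = card (\<Union>i\<in>I. C i)" "\<forall>i\<in>I. C i \<in> mono_class V col i ` V"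
      using x unfolding S_def by blast
    have "(\<Union>i\<in>I. C i) \<subseteq> V" using IC(2) K_subset by blast
    then show ?thesis unfolding IC(1) by (rule card_mono[OF finite_V])
  qed
  then have fin: "finite S" by (meson finite_nat_set_iff_bounded_le)
  obtain v where v: "v \<in> V" using V_nonempty by blast
  have "card (\<Union>i\<in>{1..k}. mono_class V col i v) \<in> S"
    unfolding S_def using v assms(3) by (auto intro!: exI[of _ "{1..k}"] exI[of _ "\<lambda>i. mono_class V col i v"])
  then show "max_coverable r V col k \<in> S" using Max_in[of S] fin unfolding M by blast
  show "x \<in> S \<Longrightarrow> x \<le> max_coverable r V col k" using fin M by simp
qed

text \<open>Serves both directions: when the optimum is known it bounds the size of every class, and
  when a class size is known it bounds the optimum from below.\<close>

lemma max_coverable_ge: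
  assumes G: "multi_colored_complete_graph r V col" and r: "r \<ge> 2" and "i \<in> {1..r}" "x \<in> V"
  shows "real (r - 1) * (real (card V) - real (max_coverable r V col (r - 1)))
    \<le> real (card V) - real (card (mono_class V col i x))"
proof -
  let ?K = "mono_class V col"
  interpret equivalence_cover r V ?K using equivalence_cover_mono_class[OF G] r by simp
  obtain j where j: "j \<in> {1..r} - {i}"
    "(r - 1) * card (V - (\<Union>k\<in>{1..r} - {j}. ?K k x)) \<le> card V - card (?K i x)"
    using exists_color_few_missed[OF assms(2-4)] by blast
  let ?U = "\<Union>k\<in>{1..r} - {j}. ?K k x"
  have U: "?U \<subseteq> V" using K_subset assms(4) by blast
  have "card ?U \<le> max_coverable r V col (r - 1)"
    by (rule max_coverable_properties(2)[OF G])
      (use r j assms(4) in \<open>auto intro!: exI[of _ "{1..r} - {j}"] exI[of _ "\<lambda>k. ?K k x"]\<close>)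
  moreover have "real (card (V - ?U)) = real (card V) - real (card ?U)"
    using card_Diff_subset[OF finite_subset[OF U finite_V] U] card_mono[OF finite_V U] by simp
  ultimately have "real (card V) - real (max_coverable r V col (r - 1)) \<le> real (card (V - ?U))" by simp
  then have "real (r - 1) * (real (card V) - real (max_coverable r V col (r - 1)))
      \<le> real (r - 1) * real (card (V - ?U))" by (intro mult_left_mono) auto
  also have "\<dots> \<le> real (card V - card (?K i x))" using j(2) by (metis of_nat_le_iff of_nat_mult)
  also have "\<dots> = real (card V) - real (card (?K i x))"
    using card_mono[OF finite_V K_subset[OF assms(4)]] by simp
  finally show ?thesis .
qed

section \<open>Counting in a finite affine plane colored by directions\<close>

locale colored_affine_plane =
  fixes q :: nat and P :: "'p set" and L :: "'p set set" and c :: "'p set \<Rightarrow> nat"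
  assumes plane: "affine_plane q P L"
    and finite_P: "finite P" and P_nonempty: "P \<noteq> {}"
    and color_iff: "l \<in> L \<Longrightarrow> l' \<in> L \<Longrightarrow> l \<noteq> l' \<Longrightarrow> c l = c l' \<longleftrightarrow> disjnt l l'"
begin

lemma line_sub: "l \<in> L \<Longrightarrow> l \<subseteq> P"
  and joining_line: "x \<in> P \<Longrightarrow> y \<in> P \<Longrightarrow> x \<noteq> y \<Longrightarrow> \<exists>!l. l \<in> L \<and> x \<in> l \<and> y \<in> l"
  and parallel_line: "x \<in> P \<Longrightarrow> l \<in> L \<Longrightarrow> x \<notin> l \<Longrightarrow> \<exists>!l'. l' \<in> L \<and> x \<in> l' \<and> disjnt l' l"
  and two_points: "l \<in> L \<Longrightarrow> \<exists>x\<in>l. \<exists>y\<in>l. x \<noteq> y"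
  and three_lines: "x \<in> P \<Longrightarrow> \<exists>M \<subseteq> L. finite M \<and> card M = 3 \<and> (\<forall>l\<in>M. x \<in> l)"
  and parallel_lines: "\<exists>S \<subseteq> L. pairwise disjnt S \<and> finite S \<and> card S = q"
  and parallel_lines_le: "S \<subseteq> L \<Longrightarrow> pairwise disjnt S \<Longrightarrow> card S \<le> q"
  using plane unfolding affine_plane_def by simp_all

lemma finite_L: "finite L"
  using line_sub finite_P by (meson Pow_iff finite_Pow_iff finite_subset subsetI)

lemma finite_line: "l \<in> L \<Longrightarrow> finite l"
  using line_sub finite_P finite_subset by blast

abbreviation lines_of :: "nat \<Rightarrow> 'p set set" where
  "lines_of i \<equiv> {l \<in> L. c l = i}"

lemma same_color_meet: "l \<in> L \<Longrightarrow> l' \<in> L \<Longrightarrow> c l = c l' \<Longrightarrow> x \<in> l \<Longrightarrow> x \<in> l' \<Longrightarrow> l = l'"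
  using color_iff by (auto simp: disjnt_def)

text \<open>Take any line of color \<open>i\<close>: either it contains \<open>x\<close>, or its
  parallel through \<open>x\<close> has the same color.\<close>

lemma line_of_color: "i \<in> c ` L \<Longrightarrow> x \<in> P \<Longrightarrow> \<exists>l\<in>L. c l = i \<and> x \<in> l"
  using parallel_line color_iff by (metis disjnt_sym imageE)

lemma different_color_meet:
  assumes "l \<in> L" "l' \<in> L" "c l \<noteq> c l'"
  shows "\<exists>x. l \<inter> l' = {x}"
proof -
  obtain x where x: "x \<in> l" "x \<in> l'" using assms color_iff by (auto simp: disjnt_def)
  have "y = x" if "y \<in> l" "y \<in> l'" for y
    using joining_line[of x y] line_sub assms x that by blast
  then show ?thesis using x by blast
qed

text \<open>Mapping a line of color \<open>j\<close> to its intersection with \<open>l\<close> is a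
  bijection onto \<open>l\<close>, since exactly one line of color \<open>j\<close> passes through
  each point of \<open>l\<close>.\<close>

lemma card_line_eq:
  assumes "l \<in> L" "j \<in> c ` L" "j \<noteq> c l"
  shows "card l = card (lines_of j)"
proof -
  have "card ((\<lambda>l'. THE x. l \<inter> l' = {x}) ` lines_of j) = card (lines_of j)"
  proof (rule card_image, rule inj_onI)
    fix k k' assume k: "k \<in> lines_of j" "k' \<in> lines_of j"
      and eq: "(THE x. l \<inter> k = {x}) = (THE x. l \<inter> k' = {x})"
    obtain x x' where x: "l \<inter> k = {x}" "l \<inter> k' = {x'}"
      using different_color_meet assms k by (metis (mono_tags, lifting) mem_Collect_eq)
    then have "x = x'" using eq by simp
    then have "x \<in> k" "x \<in> k'" using x by blast+
    then show "k = k'" using same_color_meet[of k k' x] k by simp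
  qed
  moreover have "(\<lambda>l'. THE x. l \<inter> l' = {x}) ` lines_of j = l"
  proof (intro equalityI subsetI)
    fix y assume "y \<in> (\<lambda>l'. THE x. l \<inter> l' = {x}) ` lines_of j"
    then obtain k where k: "k \<in> L" "c k = j" "y = (THE x. l \<inter> k = {x})" by blast
    obtain x where "l \<inter> k = {x}" using different_color_meet[OF assms(1) k(1)] assms k by auto
    then show "y \<in> l" using k by auto
  next
    fix y assume y: "y \<in> l"
    then obtain k where k: "k \<in> L" "c k = j" "y \<in> k" using line_of_color line_sub assms by blast
    obtain x where "l \<inter> k = {x}" using different_color_meet[OF assms(1) k(1)] assms k by auto
    then have "l \<inter> k = {y}" using y k by auto
    then show "y \<in> (\<lambda>l'. THE x. l \<inter> l' = {x}) ` lines_of j" using k by (intro image_eqI[of _ _ k]) auto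
  qed
  ultimately show ?thesis by simp
qed

text \<open>Concurrent lines are not disjoint, so three of them through one point have three
  different colors.\<close>

lemma third_color: "\<exists>k\<in>c ` L. k \<noteq> i \<and> k \<noteq> j"
proof -
  obtain x where "x \<in> P" using P_nonempty by blast
  then obtain M where M: "M \<subseteq> L" "card M = 3" "\<forall>l\<in>M. x \<in> l" using three_lines by blast
  have "inj_on c M" using M same_color_meet by (intro inj_onI) blast
  then have "card (c ` M) = 3" using M by (simp add: card_image)
  then have "\<not> c ` M \<subseteq> {i, j}" using card_mono[of "{i, j}" "c ` M"] card_insert_le_m1[of 2 "{j}" i] by force
  then show ?thesis using M by blast
qed

lemma disjoint_lines_of: "pairwise disjnt (lines_of i)"
  unfolding pairwise_def using color_iff by (metis (mono_tags, lifting) mem_Collect_eq)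

text \<open>By \<open>card_line_eq\<close>, a line of a third color has as many points as there are
  lines in either of two given colors, so all colors have equally many lines. A family of
  \<open>q\<close> parallel lines lies within one color, so this number is the maximum
  \<open>q\<close>.\<close>

lemma card_lines_of:
  assumes "i \<in> c ` L"
  shows "card (lines_of i) = q"
proof -
  have same: "card (lines_of j) = card (lines_of i)" if "j \<in> c ` L" for j
  proof -
    obtain l where l: "l \<in> L" "c l \<noteq> i" "c l \<noteq> j" using third_color by blast
    then show ?thesis using card_line_eq[of l i] card_line_eq[of l j] assms that by auto
  qed
  have le: "card (lines_of i) \<le> q" using parallel_lines_le[OF _ disjoint_lines_of] by simp
  obtain S where S: "S \<subseteq> L" "pairwise disjnt S" "finite S" "card S = q" using parallel_lines by blast
  have "\<exists>j\<in>c ` L. S \<subseteq> lines_of j"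
  proof (cases "S = {}")
    case True
    then show ?thesis using assms by blast
  next
    case False
    then obtain l where l: "l \<in> S" by blast
    have "l' \<in> lines_of (c l)" if l': "l' \<in> S" for l'
      using S(1) pairwiseD[OF S(2) l' l] color_iff[of l' l] l l' by (cases "l' = l") auto
    then have "S \<subseteq> lines_of (c l)" by blast
    then show ?thesis using l S by blast
  qed
  then obtain j where j: "j \<in> c ` L" "S \<subseteq> lines_of j" by blast
  then have "q \<le> card (lines_of j)" using S finite_L card_mono[of "lines_of j" S] by simp
  then show ?thesis using le same j by simp
qed

lemma card_line:
  assumes "l \<in> L"
  shows "card l = q"
proof -
  obtain j where "j \<in> c ` L" "j \<noteq> c l" using third_color by blast
  then show ?thesis using card_line_eq card_lines_of assms by simp
qed

lemma q_ge_2: "q \<ge> 2"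
proof -
  obtain l where l: "l \<in> L" using third_color by blast
  then obtain x y where "x \<in> l" "y \<in> l" "x \<noteq> y" using two_points by blast
  then have "card {x, y} \<le> card l" using finite_line l by (intro card_mono) auto
  then show ?thesis using \<open>x \<noteq> y\<close> card_line l by simp
qed

lemma card_P: "card P = q * q"
proof -
  obtain i where i: "i \<in> c ` L" using third_color by blast
  have "card (\<Union>(lines_of i)) = (\<Sum>l\<in>lines_of i. card l)"
    using finite_line disjoint_lines_of by (intro card_Union_disjoint) auto
  moreover have "\<Union>(lines_of i) = P" using line_sub line_of_color[OF i] by blast
  ultimately show ?thesis using card_line card_lines_of[OF i] by simp
qed

text \<open>The lines through \<open>x\<close> represent each color once and, without
  \<open>x\<close>, partition the remaining \<open>q * q - 1\<close> points into sets of size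
  \<open>q - 1\<close>.\<close>

lemma card_colors: "card (c ` L) = q + 1"
proof -
  obtain x where x: "x \<in> P" using P_nonempty by blast
  let ?X = "{l \<in> L. x \<in> l}"
  have "inj_on c ?X" using same_color_meet by (intro inj_onI) blast
  moreover have "c ` ?X = c ` L" using line_of_color x by (auto simp: image_iff) metis
  ultimately have cX: "card ?X = card (c ` L)" using card_image by fastforce
  have "card (\<Union>l\<in>?X. l - {x}) = (\<Sum>l\<in>?X. card (l - {x}))"
  proof (rule card_UN_disjoint)
    show "finite ?X" using finite_L by simp
    show "\<forall>l\<in>?X. finite (l - {x})" using finite_line by blast
    show "\<forall>l\<in>?X. \<forall>l'\<in>?X. l \<noteq> l' \<longrightarrow> (l - {x}) \<inter> (l' - {x}) = {}"
    proof (intro ballI impI)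
      fix l l' assume "l \<in> ?X" "l' \<in> ?X" "l \<noteq> l'"
      then show "(l - {x}) \<inter> (l' - {x}) = {}" using joining_line[OF x] line_sub by blast
    qed
  qed
  also have "\<dots> = (\<Sum>l\<in>?X. q - 1)" using card_line finite_line by (intro sum.cong) auto
  also have "(\<Union>l\<in>?X. l - {x}) = P - {x}"
  proof (intro equalityI subsetI)
    fix y assume "y \<in> P - {x}"
    then obtain l where "l \<in> L" "x \<in> l" "y \<in> l" using joining_line[OF x, of y] by blast
    then show "y \<in> (\<Union>l\<in>?X. l - {x})" using \<open>y \<in> P - {x}\<close> by blast
  qed (use line_sub in blast)
  finally have "card P - 1 = card (c ` L) * (q - 1)" using x finite_P cX by simp
  then have eq: "q * q - 1 = card (c ` L) * (q - 1)" using card_P by simp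
  moreover have "q * q - 1 = (q + 1) * (q - 1)" by (cases q) auto
  ultimately have "card (c ` L) * (q - 1) = (q + 1) * (q - 1)" by (simp only:)
  then show ?thesis using q_ge_2 by (simp only: mult_cancel2) auto
qed

text \<open>Every line of the family meets a fixed one, so each further line adds at most \<open>q - 1\<close> points.\<close>

lemma card_Union_lines_le:
  assumes I: "finite I" "card I = q" and C: "\<And>i. i \<in> I \<Longrightarrow> C i \<in> L \<and> c (C i) = i"
  shows "card (\<Union>i\<in>I. C i) \<le> q + (q - 1) * (q - 1)"
proof -
  obtain i where i: "i \<in> I" using I q_ge_2 by (metis card.empty ex_in_conv not_numeral_le_zero)
  have "(\<Union>i\<in>I. C i) = C i \<union> (\<Union>j\<in>I - {i}. C j - C i)" using i by blast
  then have "card (\<Union>i\<in>I. C i) \<le> card (C i) + card (\<Union>j\<in>I - {i}. C j - C i)"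
    using card_Un_le by metis
  also have "\<dots> \<le> q + (\<Sum>j\<in>I - {i}. card (C j - C i))"
    using card_line C i I card_UN_le[of "I - {i}" "\<lambda>j. C j - C i"] by simp
  also have "\<dots> = q + (\<Sum>j\<in>I - {i}. q - 1)"
  proof -
    have "card (C j - C i) = q - 1" if j: "j \<in> I - {i}" for j
    proof -
      obtain x where x: "C j \<inter> C i = {x}" using different_color_meet C i j by (metis DiffD1 DiffD2 singletonI)
      then have "C j - C i = C j - {x}" "x \<in> C j" by blast+
      then show ?thesis using card_line finite_line C j by simp
    qed
    then show ?thesis by simp
  qed
  also have "\<dots> = q + (q - 1) * (q - 1)" using I i by simp
  finally show ?thesis .
qed

end

section \<open>The optimum of a blowup, and the equivalence\<close>

lemma card_vimage_uniform:
  assumes "finite V" "finite Q" "\<And>p. p \<in> Q \<Longrightarrow> card {v \<in> V. f v = p} = b"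
  shows "card {v \<in> V. f v \<in> Q} = b * card Q"
proof -
  have "{v \<in> V. f v \<in> Q} = (\<Union>p\<in>Q. {v \<in> V. f v = p})" by blast
  then have "card {v \<in> V. f v \<in> Q} = (\<Sum>p\<in>Q. card {v \<in> V. f v = p})"
    using assms by (simp only:) (intro card_UN_disjoint, auto)
  then show ?thesis using assms(3) by simp
qed

text \<open>Components are preimages of lines. The upper bound is thus \<open>b\<close> times that
  of \<open>card_Union_lines_le\<close>; the lower bound is \<open>max_coverable_ge\<close> for a
  component, which has \<open>b * (r - 1)\<close> vertices.\<close>

lemma max_coverable_blowup:
  assumes r: "r \<ge> 2" and G: "multi_colored_complete_graph r V col"
    and plane: "affine_plane (r - 1) P L" and blowup: "is_blowup_of r V col P L"
  shows "real (max_coverable r V col (r - 1)) =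
    (1 - (real r - 2) / (real r - 1)^2) * real (card V)"
proof -
  let ?K = "mono_class V col"
  interpret equivalence_cover r V ?K using equivalence_cover_mono_class[OF G] r by simp
  obtain b :: nat and f c where b: "b > 0" and f: "f \<in> V \<rightarrow> P" and c: "c \<in> L \<rightarrow> {1..r}"
    and c_all: "\<forall>l\<in>L. \<forall>l'\<in>L. l \<noteq> l' \<longrightarrow> (c l = c l' \<longleftrightarrow> disjnt l l')"
    and f_all: "\<forall>p\<in>P. card {v \<in> V. f v = p} = b"
    and col_all: "\<forall>u\<in>V. \<forall>v\<in>V. u \<noteq> v \<longrightarrow>
      (\<forall>i. i \<in> col {u, v} \<longleftrightarrow> (\<exists>l\<in>L. f u \<in> l \<and> f v \<in> l \<and> c l = i))"
    using blowup unfolding is_blowup_of_def by - (elim exE conjE, rule that; assumption)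
  have ciff: "c l = c l' \<longleftrightarrow> disjnt l l'" if "l \<in> L" "l' \<in> L" "l \<noteq> l'" for l l'
    using c_all that by simp
  have fib: "card {v \<in> V. f v = p} = b" if "p \<in> P" for p
    using f_all that by simp
  have coliff: "i \<in> col {u, v} \<longleftrightarrow> (\<exists>l\<in>L. f u \<in> l \<and> f v \<in> l \<and> c l = i)"
    if "u \<in> V" "v \<in> V" "u \<noteq> v" for u v i
    using col_all that by blast
  have "P \<subseteq> f ` V"
  proof
    fix p assume "p \<in> P"
    then have "{v \<in> V. f v = p} \<noteq> {}" using fib b by (metis card.empty less_irrefl)
    then show "p \<in> f ` V" by blast
  qed
  then have finP: "finite P" using finite_V finite_subset by blast
  interpret A: colored_affine_plane "r - 1" P L c
    by standard (use plane finP f V_nonempty ciff in auto)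
  \<comment> \<open>The plane has \<open>(r - 1) + 1\<close> directions, so every color of the
    palette is used and no component in a palette color is a mere isolated vertex.\<close>
  have colors: "c ` L = {1..r}"
    using A.card_colors r c by (intro card_subset_eq) auto
  have cardQ: "card {v \<in> V. f v \<in> Q} = b * card Q" if "Q \<subseteq> P" for Q
    using that finite_V finite_subset[OF that finP] fib by (intro card_vimage_uniform) auto
  have "{v \<in> V. f v \<in> P} = V" using f by blast
  then have n: "card V = b * ((r - 1) * (r - 1))" using cardQ[of P] A.card_P by simp
  have cls: "\<exists>l\<in>L. c l = i \<and> ?K i v = {u \<in> V. f u \<in> l}" if i: "i \<in> {1..r}" and v: "v \<in> V" for i v
  proof -
    obtain l where l: "l \<in> L" "c l = i" "f v \<in> l" using A.line_of_color[of i "f v"] colors i v f by blast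
    have "u = v \<or> i \<in> col {u, v} \<longleftrightarrow> f u \<in> l" if "u \<in> V" for u
      using coliff[OF that v] l A.same_color_meet by blast
    then show ?thesis using l by (auto simp: mono_class_def)
  qed
  define q where "q = real r - 1"
  have q: "q \<ge> 1" "real (r - 1) = q" "real r - 2 = q - 1" "real r - 1 = q"
    using r by (auto simp: q_def)
  have nq: "real (card V) = real b * (q * q)" using n q by simp
  have target: "(1 - (real r - 2) / (real r - 1)^2) * real (card V) = real b * (q * q - q + 1)"
    unfolding nq q(3,4) using q(1) by (simp add: power2_eq_square field_simps)
  let ?M = "max_coverable r V col (r - 1)"
  obtain I C where M: "?M = card (\<Union>i\<in>I. C i)"
    and I: "I \<subseteq> {1..r}" "card I = r - 1" "\<forall>i\<in>I. C i \<in> ?K i ` V"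
    using max_coverable_properties(1)[OF G, of "r - 1"] r by auto
  have "\<exists>l. l \<in> L \<and> c l = i \<and> C i = {u \<in> V. f u \<in> l}" if i: "i \<in> I" for i
  proof -
    obtain v where "v \<in> V" "C i = ?K i v" using I(3) i by blast
    moreover have "i \<in> {1..r}" using I(1) i by (rule subsetD)
    ultimately show ?thesis using cls[of i v] by blast
  qed
  then obtain l where l: "\<And>i. i \<in> I \<Longrightarrow> l i \<in> L \<and> c (l i) = i \<and> C i = {u \<in> V. f u \<in> l i}" by metis
  have "(\<Union>i\<in>I. C i) = {u \<in> V. f u \<in> (\<Union>i\<in>I. l i)}" using l by blast
  moreover have "(\<Union>i\<in>I. l i) \<subseteq> P" using l A.line_sub by blast
  ultimately have "?M = b * card (\<Union>i\<in>I. l i)" using cardQ M by (simp only:)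
  moreover have "card (\<Union>i\<in>I. l i) \<le> (r - 1) + (r - 1 - 1) * (r - 1 - 1)"
    using l I finite_subset[OF I(1)] by (intro A.card_Union_lines_le) auto
  ultimately have "?M \<le> b * ((r - 1) + (r - 1 - 1) * (r - 1 - 1))" by simp
  then have "real ?M \<le> real (b * ((r - 1) + (r - 1 - 1) * (r - 1 - 1)))" by (rule of_nat_mono)
  also have "\<dots> = real b * (q + (q - 1) * (q - 1))" using r by (simp add: q_def of_nat_diff)
  also have "\<dots> = real b * (q * q - q + 1)" by (simp add: algebra_simps)
  finally have upper: "real ?M \<le> real b * (q * q - q + 1)" .
  obtain x where x: "x \<in> V" using V_nonempty by blast
  have one: "1 \<in> {1..r}" using r by simp
  obtain k where k: "k \<in> L" "?K 1 x = {u \<in> V. f u \<in> k}" using cls[OF one x] by blast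
  have "card (?K 1 x) = b * (r - 1)" using k cardQ A.line_sub A.card_line by simp
  then have "q * (real (card V) - real ?M) \<le> real b * (q * q) - real b * q"
    using max_coverable_ge[OF G r one x] q(2) nq by simp
  also have "\<dots> = q * (real b * (q - 1))" by (simp add: algebra_simps)
  finally have "real (card V) - real ?M \<le> real b * (q - 1)" using q(1) by simp
  then have "real b * (q * q - q + 1) \<le> real ?M" using nq by (simp add: algebra_simps)
  then show ?thesis using upper target by simp
qed

theorem theorem9:
  fixes r :: nat and V :: "'a set" and col :: "'a set \<Rightarrow> nat set"
  assumes "r \<ge> 3"
    and "multi_colored_complete_graph r V col"
  shows "real (max_coverable r V col (r - 1)) =
           (1 - (real r - 2) / (real r - 1)^2) * real (card V)
         \<longleftrightarrow> is_affine_plane_blowup r V col"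
proof
  assume "is_affine_plane_blowup r V col"
  then show "real (max_coverable r V col (r - 1)) =
           (1 - (real r - 2) / (real r - 1)^2) * real (card V)"
    unfolding is_affine_plane_blowup_def using max_coverable_blowup[of r] assms by auto
next
  let ?K = "mono_class V col"
  interpret equivalence_cover r V ?K using equivalence_cover_mono_class[OF assms(2)] assms(1) by simp
  assume eq: "real (max_coverable r V col (r - 1)) =
           (1 - (real r - 2) / (real r - 1)^2) * real (card V)"
  define q where "q = real (r - 1)"
  define n where "n = real (card V)"
  have q: "q \<ge> 2" "real r - 2 = q - 1" "real r - 1 = q" using assms(1) by (auto simp: q_def)
  interpret extremal_cover r V ?K
  proof
    fix i v assume iv: "i \<in> {1..r}" "v \<in> V"
    \<comment> \<open>The assumed optimum leaves \<open>n * (q - 1) / q^2\<close> vertices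
      uncovered; \<open>q\<close> times this is \<open>n - n / q\<close>, which leaves at most
      \<open>n / q\<close> for the class.\<close>
    have "q * (n - (1 - (q - 1) / q\<^sup>2) * n) \<le> n - real (card (?K i v))"
      using max_coverable_ge[OF assms(2) _ iv] assms(1) eq unfolding q(2,3) by (simp add: q_def n_def)
    moreover have "q * (n - (1 - (q - 1) / q\<^sup>2) * n) = n - n / q"
      using q(1) by (simp add: power2_eq_square field_simps)
    ultimately have "real (card (?K i v)) \<le> n / q" by linarith
    then have "q * real (card (?K i v)) \<le> n" using q(1) by (simp add: field_simps)
    then show "(r - 1) * card (?K i v) \<le> card V"
      unfolding q_def n_def by (metis of_nat_le_iff of_nat_mult)
  qed (use assms in auto)
  have "i \<in> col {u, v} \<longleftrightarrow> i \<in> {1..r} \<and> u \<in> ?K i v" if "u \<in> V" "v \<in> V" "u \<noteq> v" for u v i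
    using that assms(2) unfolding multi_colored_complete_graph_def mono_class_def by blast
  then have "is_blowup_of r V col (point ` V) all_lines" by (rule extremal_is_blowup)
  then show "is_affine_plane_blowup r V col"
    unfolding is_affine_plane_blowup_def using affine_plane_points_lines by blast
qed

end
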